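(* Let $\{\phi_j(x)\}_{j\ge0}$ be a degree-graded polynomial basis satisfying a three-term recurrence with coefficients $\alpha_j,\beta_j,\gamma_j$, and let $n,m,k$ be non-negative integers with $0\le k\le m$. Then $$\phi_{k,m}(x)\,\mathbf\Phi_n(x)=\tilde{\mathbf H}_{n,k}\,\mathbf\Phi_{n+m}(x),\qquad \tilde{\mathbf H}_{n,k}=\bigl[\,\mathbf H_{n,k}\ \big|\ \mathbf 0_{(n+1)\times(m-k)}\,\bigr],$$ where $\mathbf H_{n,k}$ is the $(n+1)\times(n+k+1)$ matrix whose entries (rows $i=1,\dots,n+1$, columns $j=1,\dots,n+k+1$) are given recursively by: $\mathbf H_{n,k}[i,j]=1$ if $i=1$ and $j=k+1$; $\mathbf H_{n,k}[i,j]=0$ if $j\le|k+1-i|$ or $j\ge k+1+i$; and in all remaining cases $$\mathbf H_{n,k}[i,j]=\frac{1}{\alpha_{i-2}}\Bigl(\alpha_{j-2}\mathbf H_{n,k}[i-1,j-1]+(\beta_{j-1}-\beta_{i-2})\mathbf H_{n,k}[i-1,j]+\gamma_j\mathbf H_{n,k}[i-1,j+1]-\gamma_{i-2}\mathbf H_{n,k}[i-2,j]\Bigr).$$ Here entries $\mathbf H_{n,k}[i,j]$ with any negative or zero index, or with $j>n+k+1$, are set to $0$.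
   Context: A degree-graded polynomial basis is a family of real polynomials $\{\phi_j(x)\}_{j=0}^\infty$ with $\deg\phi_j=j$, $\phi_0=1$, $\phi_{-1}=0$, satisfying $x\phi_j(x)=\alpha_j\phi_{j+1}(x)+\beta_j\phi_j(x)+\gamma_j\phi_{j-1}(x)$ for $j=0,1,2,\dots$, where $\alpha_j,\beta_j,\gamma_j$ are real and $\alpha_j\ne0$ (orthogonality is not assumed). Notation: $\phi_{j,n}(x)=\phi_j(x)$ for $0\le j\le n$ (the second index only records a maximum degree), and $\mathbf\Phi_n(x)=[\phi_0(x),\dots,\phi_n(x)]^T$. Terms involving undefined coefficients such as $\alpha_{-1}$ are multiplied by zero entries and are read as $0$. *)

theory Defs
  imports
    "Jordan_Normal_Form.Matrix"
    "HOL-Computational_Algebra.Polynomial"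
begin

text \<open>
  The family is indexed by \<^typ>\<open>nat\<close>; the convention that the member with index \<open>-1\<close> is zero
  appears as the case distinction in the recurrence. No condition is imposed on \<open>\<gamma>\<close>.
\<close>

definition degree_graded_basis ::
  "(nat \<Rightarrow> real poly) \<Rightarrow> (nat \<Rightarrow> real) \<Rightarrow> (nat \<Rightarrow> real) \<Rightarrow> (nat \<Rightarrow> real) \<Rightarrow> bool" where
  "degree_graded_basis \<phi> \<alpha> \<beta> \<gamma> \<longleftrightarrow>
     (\<forall>j. degree (\<phi> j) = j) \<and> \<phi> 0 = 1 \<and> (\<forall>j. \<alpha> j \<noteq> 0) \<and>
     (\<forall>j. [:0, 1:] * \<phi> j =
            smult (\<alpha> j) (\<phi> (j + 1)) + smult (\<beta> j) (\<phi> j)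
            + smult (\<gamma> j) (if j = 0 then 0 else \<phi> (j - 1)))"

definition Phi_vec :: "(nat \<Rightarrow> 'a) \<Rightarrow> nat \<Rightarrow> 'a vec" where
  "Phi_vec \<phi> n = vec (n + 1) \<phi>"

text \<open>
  Row and column indices \<open>i\<close> and \<open>j\<close> start at 1. The recursive case is reached only
  for \<open>i \<ge> 2\<close>, so the only truncated subtraction is \<open>j - 2\<close> for \<open>j = 1\<close>, standing for the
  undefined coefficient \<open>\<alpha>\<close> with index \<open>-1\<close>; there it is multiplied by an entry of column 0,
  which is zero.
\<close>

fun H_entry ::
  "(nat \<Rightarrow> real) \<Rightarrow> (nat \<Rightarrow> real) \<Rightarrow> (nat \<Rightarrow> real) \<Rightarrow> nat \<Rightarrow> nat \<Rightarrow> nat \<Rightarrow> nat \<Rightarrow> real" where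
  "H_entry \<alpha> \<beta> \<gamma> n k i j =
    (if i = 0 \<or> j = 0 \<or> j > n + k + 1 then 0
     else if i = 1 \<and> j = k + 1 then 1
     else if int j \<le> \<bar>int k + 1 - int i\<bar> \<or> j \<ge> k + 1 + i then 0
     else 1 / \<alpha> (i - 2) *
       (\<alpha> (j - 2) * H_entry \<alpha> \<beta> \<gamma> n k (i - 1) (j - 1)
        + (\<beta> (j - 1) - \<beta> (i - 2)) * H_entry \<alpha> \<beta> \<gamma> n k (i - 1) j
        + \<gamma> j * H_entry \<alpha> \<beta> \<gamma> n k (i - 1) (j + 1)
        - \<gamma> (i - 2) * H_entry \<alpha> \<beta> \<gamma> n k (i - 2) j))"

declare H_entry.simps [simp del]

text \<open>Matrices of type \<open>'a mat\<close> are indexed from 0, hence the shift.\<close>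

definition H_mat ::
  "(nat \<Rightarrow> real) \<Rightarrow> (nat \<Rightarrow> real) \<Rightarrow> (nat \<Rightarrow> real) \<Rightarrow> nat \<Rightarrow> nat \<Rightarrow> real mat" where
  "H_mat \<alpha> \<beta> \<gamma> n k =
     mat (n + 1) (n + k + 1) (\<lambda>(i, j). H_entry \<alpha> \<beta> \<gamma> n k (i + 1) (j + 1))"

definition append_cols :: "'a :: zero mat \<Rightarrow> 'a mat \<Rightarrow> 'a mat" where
  "append_cols A B = four_block_mat A B (0\<^sub>m 0 (dim_col A)) (0\<^sub>m 0 (dim_col B))"

definition H_tilde ::
  "(nat \<Rightarrow> real) \<Rightarrow> (nat \<Rightarrow> real) \<Rightarrow> (nat \<Rightarrow> real) \<Rightarrow> nat \<Rightarrow> nat \<Rightarrow> nat \<Rightarrow> real mat" where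
  "H_tilde \<alpha> \<beta> \<gamma> n m k = append_cols (H_mat \<alpha> \<beta> \<gamma> n k) (0\<^sub>m (n + 1) (m - k))"

end

(* The recursion of the paper, run without its two vanishing conditions, yields the coefficients of
   the expansion of phi_k * phi_a in the basis: this is the three-term recurrence for phi_a
   multiplied by phi_k. The condition on large j and the half k - a > b of the
   other one come from bandwidth. The half a - k > b is not visible in the recursion; it follows
   by exchanging the two factors, since expansions in the basis are unique. *)
theory Submission
  imports Defs
begin

text \<open>Indices start at 0, so \<open>a\<close> and \<open>b\<close> stand for row
  \<open>a + 1\<close> and column \<open>b + 1\<close> of the matrix. There is no size parameter
  \<open>n\<close> and hence no cutoff in the columns; the guards for \<open>b = 0\<close> and
  \<open>a = 0\<close> stand for the zero column and the zero row.\<close>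

fun product_coeff ::
  "(nat \<Rightarrow> real) \<Rightarrow> (nat \<Rightarrow> real) \<Rightarrow> (nat \<Rightarrow> real) \<Rightarrow> nat \<Rightarrow> nat \<Rightarrow> nat \<Rightarrow> real" where
  "product_coeff \<alpha> \<beta> \<gamma> k 0 b = (if b = k then 1 else 0)"
| "product_coeff \<alpha> \<beta> \<gamma> k (Suc a) b =
    1 / \<alpha> a *
      ((if b = 0 then 0 else \<alpha> (b - 1) * product_coeff \<alpha> \<beta> \<gamma> k a (b - 1))
       + (\<beta> b - \<beta> a) * product_coeff \<alpha> \<beta> \<gamma> k a b
       + \<gamma> (b + 1) * product_coeff \<alpha> \<beta> \<gamma> k a (b + 1)
       - (if a = 0 then 0 else \<gamma> a * product_coeff \<alpha> \<beta> \<gamma> k (a - 1) b))"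

text \<open>Row 0 has its single nonzero entry at \<open>b = k\<close>, and each further row reaches
  at most one column more to either side.\<close>

lemma product_coeff_eq_0:
  assumes "a + k < b \<or> a + b < k"
  shows "product_coeff \<alpha> \<beta> \<gamma> k a b = 0"
  using assms
proof (induction a arbitrary: b rule: less_induct)
  case (less a)
  show ?case
  proof (cases a)
    case 0
    then show ?thesis using less.prems by auto
  next
    case (Suc a')
    let ?c = "product_coeff \<alpha> \<beta> \<gamma> k"
    have "(if b = 0 then 0 else \<alpha> (b - 1) * ?c a' (b - 1)) = 0"
      using less.prems Suc less.IH[of a' "b - 1"] by (simp del: product_coeff.simps) linarith
    moreover have "?c a' b = 0" "?c a' (b + 1) = 0"
      using less.prems Suc by (auto intro!: less.IH)
    moreover have "(if a' = 0 then 0 else \<gamma> a' * ?c (a' - 1) b) = 0"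
      using less.prems Suc less.IH[of "a' - 1" b] by (simp del: product_coeff.simps) linarith
    ultimately show ?thesis
      by (simp only: Suc product_coeff.simps(2) mult_zero_right add_0_left diff_self)
  qed
qed

lemma smult_sum_right: "smult c (\<Sum>i\<in>S. f i) = (\<Sum>i\<in>S. smult c (f i))"
  by (induction S rule: infinite_finite_induct) (auto simp: smult_add_right)

lemma degree_graded_basisD:
  assumes "degree_graded_basis \<phi> \<alpha> \<beta> \<gamma>"
  shows "degree (\<phi> j) = j" "\<phi> 0 = 1" "\<alpha> j \<noteq> 0"
    "[:0, 1:] * \<phi> j = smult (\<alpha> j) (\<phi> (Suc j)) + smult (\<beta> j) (\<phi> j)
      + smult (\<gamma> j) (if j = 0 then 0 else \<phi> (j - 1))"
  using assms by (auto simp: degree_graded_basis_def)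

text \<open>Only the top term reaches degree \<open>Suc N\<close>, so its coefficient vanishes and
  the sum gets shorter. The degrees do not exclude \<open>\<phi> 0 = 0\<close>, since the zero
  polynomial has degree 0; the second assumption does.\<close>

lemma graded_independent:
  fixes \<phi> :: "nat \<Rightarrow> 'a :: idom poly"
  assumes "\<And>j. degree (\<phi> j) = j" "\<phi> 0 \<noteq> 0"
    and "(\<Sum>b\<le>N. smult (e b) (\<phi> b)) = 0" "b \<le> N"
  shows "e b = 0"
  using assms(3,4)
proof (induction N)
  case 0
  then show ?case using assms(2) by simp
next
  case (Suc N)
  have "degree (\<Sum>b\<le>N. smult (e b) (\<phi> b)) \<le> N"
    using assms(1) by (intro degree_sum_le) (auto intro: order_trans[OF degree_smult_le])
  then have "coeff (\<Sum>b\<le>N. smult (e b) (\<phi> b)) (Suc N) = 0"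
    by (intro coeff_eq_0) simp
  then have "coeff (\<Sum>b\<le>Suc N. smult (e b) (\<phi> b)) (Suc N) = e (Suc N) * lead_coeff (\<phi> (Suc N))"
    by (simp only: sum.atMost_Suc coeff_add coeff_smult assms(1) add_0_left)
  moreover have "\<phi> (Suc N) \<noteq> 0" using assms(1)[of "Suc N"] by auto
  ultimately have "e (Suc N) = 0"
    unfolding Suc.prems(1) by simp
  then show ?case using Suc by (auto simp: le_Suc_eq)
qed

text \<open>The last two terms are boundary corrections: \<open>\<phi> N\<close> sends a
  contribution up to \<open>\<phi> (Suc N)\<close>, outside the range, while the coefficient at
  \<open>b = N\<close> counts one coming down from \<open>\<phi> (Suc N)\<close>, which is not in
  the sum on the left. Increasing \<open>N\<close> absorbs the first and cancels the second.\<close>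

lemma x_times_expansion:
  assumes "degree_graded_basis \<phi> \<alpha> \<beta> \<gamma>"
  shows "[:0, 1:] * (\<Sum>b\<le>N. smult (h b) (\<phi> b)) =
    (\<Sum>b\<le>N. smult ((if b = 0 then 0 else \<alpha> (b - 1) * h (b - 1)) + \<beta> b * h b
                  + \<gamma> (b + 1) * h (b + 1)) (\<phi> b))
    + smult (\<alpha> N * h N) (\<phi> (Suc N)) - smult (\<gamma> (Suc N) * h (Suc N)) (\<phi> N)"
proof (induction N)
  case 0
  have "[:0, 1:] * smult (h 0) (\<phi> 0) = smult (h 0) ([:0, 1:] * \<phi> 0)" by simp
  then show ?case
    unfolding degree_graded_basisD(4)[OF assms]
    by (simp add: smult_add_right smult_add_left mult.commute del: mult_pCons_left)
next
  case (Suc N)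
  have "[:0, 1:] * smult (h (Suc N)) (\<phi> (Suc N)) = smult (h (Suc N)) ([:0, 1:] * \<phi> (Suc N))"
    by simp
  then show ?case
    unfolding degree_graded_basisD(4)[OF assms] sum.atMost_Suc distrib_left Suc.IH
    by (simp add: smult_add_right smult_add_left mult.commute del: mult_pCons_left)
qed

text \<open>The bound \<open>N\<close> is any number that is large enough, so that one range of
  summation serves all rows of the induction.\<close>

lemma product_expansion:
  assumes "degree_graded_basis \<phi> \<alpha> \<beta> \<gamma>" and "a + k \<le> N"
  shows "\<phi> k * \<phi> a = (\<Sum>b\<le>N. smult (product_coeff \<alpha> \<beta> \<gamma> k a b) (\<phi> b))"
  using assms(2)
proof (induction a rule: less_induct)
  case (less a)
  note basis = degree_graded_basisD[OF assms(1)]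
  let ?c = "product_coeff \<alpha> \<beta> \<gamma> k"
  let ?S = "\<lambda>h. \<Sum>b\<le>N. smult (h b) (\<phi> b)"
  show ?case
  proof (cases a)
    case 0
    have "?S (?c 0) = (\<Sum>b\<le>N. if b = k then \<phi> b else 0)"
      by (intro sum.cong) auto
    then show ?thesis using 0 less.prems by (simp add: basis(2))
  next
    case (Suc d)
    let ?prev = "\<lambda>b. if d = 0 then 0 else ?c (d - 1) b"
    let ?x = "\<lambda>b. (if b = 0 then 0 else \<alpha> (b - 1) * ?c d (b - 1)) + \<beta> b * ?c d b
                  + \<gamma> (b + 1) * ?c d (b + 1)"
    have IH: "\<phi> k * \<phi> d = ?S (?c d)"
      using less Suc by auto
    have IH': "\<phi> k * (if d = 0 then 0 else \<phi> (d - 1)) = ?S ?prev"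
      using less Suc by auto
    \<comment> \<open>Both boundary corrections vanish: \<open>d + k < N\<close>, so row
      \<open>d\<close> is zero at \<open>N\<close> and at \<open>Suc N\<close>.\<close>
    have "[:0, 1:] * ?S (?c d) = ?S ?x"
      using less.prems Suc
      by (subst x_times_expansion[OF assms(1)]) (simp add: product_coeff_eq_0)
    then have x: "\<phi> k * ([:0, 1:] * \<phi> d) = ?S ?x"
      unfolding IH[symmetric] by (metis mult.left_commute)
    have "smult (\<alpha> d) (\<phi> (Suc d)) = [:0, 1:] * \<phi> d - smult (\<beta> d) (\<phi> d)
        - smult (\<gamma> d) (if d = 0 then 0 else \<phi> (d - 1))"
      unfolding basis(4) by simp
    then have "\<phi> k * smult (\<alpha> d) (\<phi> (Suc d)) = \<phi> k * ([:0, 1:] * \<phi> d)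
        - smult (\<beta> d) (\<phi> k * \<phi> d) - smult (\<gamma> d) (\<phi> k * (if d = 0 then 0 else \<phi> (d - 1)))"
      by (simp only: right_diff_distrib mult_smult_right)
    also have "\<dots> = ?S ?x - smult (\<beta> d) (?S (?c d)) - smult (\<gamma> d) (?S ?prev)"
      unfolding x IH IH' ..
    also have "\<dots> = ?S (\<lambda>b. ?x b - \<beta> d * ?c d b - \<gamma> d * ?prev b)"
      by (simp only: smult_sum_right sum_subtractf smult_diff_left smult_smult)
    \<comment> \<open>This is the defining recursion for row \<open>Suc d\<close> with the division
      by \<open>\<alpha> d\<close> cleared.\<close>
    also have "\<dots> = ?S (\<lambda>b. \<alpha> d * ?c (Suc d) b)"
      using basis(3)[of d] by (intro sum.cong refl arg_cong2[of _ _ _ _ smult])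
        (auto simp: algebra_simps)
    also have "\<dots> = smult (\<alpha> d) (?S (?c (Suc d)))"
      by (simp only: smult_sum_right smult_smult)
    finally have "smult (\<alpha> d) (\<phi> k * \<phi> (Suc d)) = smult (\<alpha> d) (?S (?c (Suc d)))"
      by simp
    then have "smult (inverse (\<alpha> d)) (smult (\<alpha> d) (\<phi> k * \<phi> (Suc d)))
        = smult (inverse (\<alpha> d)) (smult (\<alpha> d) (?S (?c (Suc d))))"
      by (rule arg_cong)
    then show ?thesis
      unfolding smult_smult left_inverse[OF basis(3)] smult_1_left Suc .
  qed
qed

lemma product_coeff_commute:
  assumes "degree_graded_basis \<phi> \<alpha> \<beta> \<gamma>"
  shows "product_coeff \<alpha> \<beta> \<gamma> k a b = product_coeff \<alpha> \<beta> \<gamma> a k b"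
proof -
  \<comment> \<open>Large enough for both expansions and for the index \<open>b\<close> to lie in
    the range.\<close>
  let ?N = "a + k + b"
  have "(\<Sum>b\<le>?N. smult (product_coeff \<alpha> \<beta> \<gamma> k a b - product_coeff \<alpha> \<beta> \<gamma> a k b) (\<phi> b))
      = \<phi> k * \<phi> a - \<phi> a * \<phi> k"
    using product_expansion[OF assms, of a k ?N] product_expansion[OF assms, of k a ?N]
    by (simp add: smult_diff_left sum_subtractf)
  then have "product_coeff \<alpha> \<beta> \<gamma> k a b - product_coeff \<alpha> \<beta> \<gamma> a k b = 0"
    using degree_graded_basisD[OF assms]
    by (intro graded_independent[of \<phi> "\<lambda>b. _ b - _ b" ?N]) auto
  then show ?thesis by simp
qed

text \<open>The bound \<open>a \<le> n\<close> makes the cutoff at column \<open>n + k + 1\<close>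
  harmless: beyond it \<open>b > a + k\<close>, where the coefficient is zero anyway.\<close>

lemma H_entry_eq_product_coeff:
  assumes "degree_graded_basis \<phi> \<alpha> \<beta> \<gamma>" and "a \<le> n"
  shows "H_entry \<alpha> \<beta> \<gamma> n k (Suc a) (Suc b) = product_coeff \<alpha> \<beta> \<gamma> k a b"
  using assms(2)
proof (induction a arbitrary: b rule: less_induct)
  case (less a)
  consider "a + k < b \<or> a + b < k \<or> k + b < a" | "a = 0" "b = k"
    | d where "a = Suc d" "b \<le> a + k" "k \<le> a + b" "a \<le> k + b"
    by (cases a) force+
  then show ?case
  proof cases
    case 1
    then have "H_entry \<alpha> \<beta> \<gamma> n k (Suc a) (Suc b) = 0"
      by (subst H_entry.simps) auto
    \<comment> \<open>For \<open>k + b < a\<close> the bandwidth bound is applied to the coefficient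
      with \<open>a\<close> and \<open>k\<close> exchanged.\<close>
    moreover have "product_coeff \<alpha> \<beta> \<gamma> k a b = 0"
      using 1 product_coeff_eq_0[of a k b] product_coeff_eq_0[of k a b]
        product_coeff_commute[OF assms(1)] by (metis add.commute)
    ultimately show ?thesis by simp
  next
    case 2
    then show ?thesis by (subst H_entry.simps) auto
  next
    case 3
    have zero: "H_entry \<alpha> \<beta> \<gamma> n k i 0 = 0" "H_entry \<alpha> \<beta> \<gamma> n k 0 j = 0" for i j
      by (simp_all add: H_entry.simps)
    have d: "H_entry \<alpha> \<beta> \<gamma> n k (Suc d) (Suc j) = product_coeff \<alpha> \<beta> \<gamma> k d j" for j
      using less 3 by auto
    have d': "H_entry \<alpha> \<beta> \<gamma> n k d (Suc b)
        = (if d = 0 then 0 else product_coeff \<alpha> \<beta> \<gamma> k (d - 1) b)"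
      using less.IH[of "d - 1"] less.prems 3 zero by auto
    have left: "H_entry \<alpha> \<beta> \<gamma> n k (Suc d) b
        = (if b = 0 then 0 else product_coeff \<alpha> \<beta> \<gamma> k d (b - 1))"
      using d[of "b - 1"] zero by auto
    \<comment> \<open>With \<open>i = Suc (Suc d)\<close> and \<open>j = Suc b\<close>, the index
      \<open>i - 2\<close> is \<open>d\<close> and \<open>j - 2\<close> is \<open>b - 1\<close>. At
      \<open>b = 0\<close> the latter is truncated, but its factor lies in column 0 and is
      zero.\<close>
    have "H_entry \<alpha> \<beta> \<gamma> n k (Suc a) (Suc b) = 1 / \<alpha> d *
       (\<alpha> (b - 1) * H_entry \<alpha> \<beta> \<gamma> n k (Suc d) b
        + (\<beta> b - \<beta> d) * H_entry \<alpha> \<beta> \<gamma> n k (Suc d) (Suc b)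
        + \<gamma> (Suc b) * H_entry \<alpha> \<beta> \<gamma> n k (Suc d) (Suc (Suc b))
        - \<gamma> d * H_entry \<alpha> \<beta> \<gamma> n k d (Suc b))"
      using 3 less.prems by (subst H_entry.simps) (auto simp: numeral_2_eq_2)
    then show ?thesis
      unfolding d d' left 3(1) by simp
  qed
qed

lemma H_tilde_dim [simp]:
  assumes "k \<le> m"
  shows "dim_row (H_tilde \<alpha> \<beta> \<gamma> n m k) = n + 1" "dim_col (H_tilde \<alpha> \<beta> \<gamma> n m k) = n + m + 1"
  using assms by (simp_all add: H_tilde_def append_cols_def H_mat_def)

text \<open>In the appended zero columns \<open>b > n + k \<ge> a + k\<close>, so the coefficient
  vanishes there as well.\<close>

lemma H_tilde_index:
  assumes "degree_graded_basis \<phi> \<alpha> \<beta> \<gamma>" and "k \<le> m" "a \<le> n" "b \<le> n + m"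
  shows "H_tilde \<alpha> \<beta> \<gamma> n m k $$ (a, b) = product_coeff \<alpha> \<beta> \<gamma> k a b"
  using assms
  by (auto simp: H_tilde_def append_cols_def H_mat_def H_entry_eq_product_coeff product_coeff_eq_0)

theorem lemma4p1:
  fixes \<phi> :: "nat \<Rightarrow> real poly" and \<alpha> \<beta> \<gamma> :: "nat \<Rightarrow> real" and n m k :: nat
  assumes "degree_graded_basis \<phi> \<alpha> \<beta> \<gamma>"
    and "k \<le> m"
  shows "\<phi> k \<cdot>\<^sub>v Phi_vec \<phi> n =
    map_mat (\<lambda>c. [:c:]) (H_tilde \<alpha> \<beta> \<gamma> n m k) *\<^sub>v Phi_vec \<phi> (n + m)"
proof (rule eq_vecI)
  fix a
  assume "a < dim_vec (map_mat (\<lambda>c. [:c:]) (H_tilde \<alpha> \<beta> \<gamma> n m k) *\<^sub>v Phi_vec \<phi> (n + m))"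
  then have a: "a \<le> n" using assms(2) by simp
  have "(map_mat (\<lambda>c. [:c:]) (H_tilde \<alpha> \<beta> \<gamma> n m k) *\<^sub>v Phi_vec \<phi> (n + m)) $ a
      = (\<Sum>b\<in>{0..<n + m + 1}. [:H_tilde \<alpha> \<beta> \<gamma> n m k $$ (a, b):] * \<phi> b)"
    using a assms(2) by (simp add: scalar_prod_def Phi_vec_def del: sum.op_ivl_Suc)
  also have "\<dots> = (\<Sum>b\<le>n + m. smult (product_coeff \<alpha> \<beta> \<gamma> k a b) (\<phi> b))"
    using a assms by (intro sum.cong) (auto simp: H_tilde_index)
  \<comment> \<open>The expansion applies up to \<open>n + m\<close> because
    \<open>a \<le> n\<close> and \<open>k \<le> m\<close>.\<close>
  also have "\<dots> = (\<phi> k \<cdot>\<^sub>v Phi_vec \<phi> n) $ a"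
    using a assms(2) product_expansion[OF assms(1), of a k "n + m"] by (simp add: Phi_vec_def)
  finally show "(\<phi> k \<cdot>\<^sub>v Phi_vec \<phi> n) $ a
      = (map_mat (\<lambda>c. [:c:]) (H_tilde \<alpha> \<beta> \<gamma> n m k) *\<^sub>v Phi_vec \<phi> (n + m)) $ a" ..
qed (use assms(2) in \<open>simp add: Phi_vec_def\<close>)

end
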